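(* Let $X$ be the discrete-time Markov chain on $\mathscr{X}$ associated with $\rho$, $\nu$ and the policy $\phi$ defined in the context. Assume that $X$ is irreducible. Then $X$ is stable (positive recurrent) if and only if $(\mathcal{G}_\rho,\nu)$ satisfies NCOND.
   Context: $\mathbb{N}_0=\{0,1,2,\dots\}$, $\mathbb{N}=\{1,2,\dots\}$. $\mathcal{C}$ is a finite set, $\nu$ a probability on $\mathcal{C}$ with $\nu(i)>0$ for all $i$, and $\rho\in[0,1]^{\mathcal{C}\times\mathcal{C}}$ a symmetric matrix. Root graph and NCOND. $\mathcal{E}_\rho(i,j)=\mathbf{1}\{\rho(i,j)>0\}$, and $\mathcal{G}_\rho=(\mathcal{C},\mathcal{E}_\rho)$ is the undirected graph (self-loops allowed) with this adjacency matrix. $\mathcal{I}\subset\mathcal{C}$ is $\mathcal{G}_\rho$-independent if $\mathcal{E}_\rho(i,j)=0$ for all $i,j\in\mathcal{I}$ (including $i=j$); $\mathbb{I}_\rho$ is the collection of non-empty $\mathcal{G}_\rho$-independent sets. $\mathcal{N}_\rho(\mathcal{A})=\{j:\mathcal{E}_\rho(i,j)=1\text{ for some }i\in\mathcal{A}\}$, $\nu(\mathcal{A})=\sum_{i\in\mathcal{A}}\nu(i)$. NCOND means $\nu(\mathcal{I})<\nu(\mathcal{N}_\rho(\mathcal{I}))$ for all $\mathcal{I}\in\mathbb{I}_\rho$. Weight function $w:\mathbb{N}_0\times[0,1]\to[0,\infty)$, assumed to satisfy: (w1) $w(n,r)>0$ if and only if $n>0$ and $r>0$. (w2) $w$ is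 non-decreasing in each coordinate. (w3) For every $r\in(0,1]$ there is $m(r)\in\mathbb{N}$ such that $w(n-1,1)<w(n,r)$ and $w(n,1)<w(n+1,r)$ for every $n\ge m(r)$. Policy. Fix a bijection $\alpha:\mathcal{C}\to\{1,\dots,|\mathcal{C}|\}$. Then $\phi(x,i)=\arg\max_{j\in\mathcal{C}}(w(x(j),\rho(i,j)),\alpha(j))$ with the lexicographical order on pairs. Markov chain. With $1_i\in\mathbb{N}_0^{\mathcal{C}}$ the canonical vector and $0^0=1$, the only non-zero transition probabilities are $P(x,x+1_i)=\nu(i)(1-\rho(i,\phi(x,i)))^{x(\phi(x,i))}$, and, when $x-1_j\in\mathbb{N}_0^{\mathcal{C}}$, $P(x,x-1_j)=\sum_{i:\phi(x,i)=j}\nu(i)[1-(1-\rho(i,j))^{x(j)}]$. The chain $X=(X_t)_{t\in\mathbb{N}_0}$ starts from $X_0=0$ and its state space is $\mathscr{X}=\{x\in\mathbb{N}_0^{\mathcal{C}}:\mathbb{P}(X_t=x)>0\text{ for some }t\in\mathbb{N}_0\}$. An irreducible chain is called stable (positive recurrent) if there exists a unique invariant distribution. *)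

theory Defs
  imports "HOL-Probability.Probability"
begin

section \<open>Root graph and the condition NCOND\<close>

definition root_edge :: "('c \<Rightarrow> 'c \<Rightarrow> real) \<Rightarrow> 'c \<Rightarrow> 'c \<Rightarrow> bool" where
  "root_edge \<rho> i j \<longleftrightarrow> \<rho> i j > 0"

text \<open>Self-loops are allowed, and a vertex carrying one lies in no independent set.\<close>

definition graph_independent :: "('c \<Rightarrow> 'c \<Rightarrow> bool) \<Rightarrow> 'c set \<Rightarrow> bool" where
  "graph_independent E A \<longleftrightarrow> (\<forall>i\<in>A. \<forall>j\<in>A. \<not> E i j)"

definition neighbourhood :: "('c \<Rightarrow> 'c \<Rightarrow> bool) \<Rightarrow> 'c set \<Rightarrow> 'c set" where
  "neighbourhood E A = {j. \<exists>i\<in>A. E i j}"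

definition NCOND :: "('c::finite \<Rightarrow> 'c \<Rightarrow> bool) \<Rightarrow> ('c \<Rightarrow> real) \<Rightarrow> bool" where
  "NCOND E \<nu> \<longleftrightarrow>
     (\<forall>I. I \<noteq> {} \<longrightarrow> graph_independent E I \<longrightarrow> sum \<nu> I < sum \<nu> (neighbourhood E I))"

section \<open>Weights, policy and transition probabilities\<close>

text \<open>The second argument of a weight function ranges over \<open>[0, 1]\<close>; its values
  elsewhere are left unconstrained and are never used.\<close>

definition weight_function :: "(nat \<Rightarrow> real \<Rightarrow> real) \<Rightarrow> bool" where
  "weight_function w \<longleftrightarrow>
     (\<forall>n. \<forall>r\<in>{0..1}. w n r \<ge> 0) \<and>
     (\<forall>n. \<forall>r\<in>{0..1}. w n r > 0 \<longleftrightarrow> n > 0 \<and> r > 0) \<and>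
     (\<forall>r\<in>{0..1}. mono (\<lambda>n. w n r)) \<and>
     (\<forall>n. mono_on {0..1} (w n)) \<and>
     (\<forall>r\<in>{0<..1}. \<exists>m\<ge>1. \<forall>n\<ge>m. w (n - 1) 1 < w n r \<and> w n 1 < w (n + 1) r)"

text \<open>The maximiser of the pairs \<open>(w (x j) (\<rho> i j), \<alpha> j)\<close> in the lexicographical order;
  it exists and is unique because \<open>\<alpha>\<close> is injective and \<open>'c\<close> is finite.\<close>

definition policy ::
  "(nat \<Rightarrow> real \<Rightarrow> real) \<Rightarrow> ('c::finite \<Rightarrow> 'c \<Rightarrow> real) \<Rightarrow> ('c \<Rightarrow> nat) \<Rightarrow> ('c \<Rightarrow> nat) \<Rightarrow> 'c \<Rightarrow> 'c"
where
  "policy w \<rho> \<alpha> x i =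
     (THE j. \<forall>k. k \<noteq> j \<longrightarrow>
        ((w (x k) (\<rho> i k), \<alpha> k), (w (x j) (\<rho> i j), \<alpha> j))
          \<in> {(a, b). a < b} <*lex*> {(a, b). a < b})"

text \<open>Given \<open>x\<close> and \<open>y\<close>, at most one term of the two outer sums is selected by its condition, so
  these are the arrival probabilities \<open>P(x, x + 1\<^sub>i)\<close> and departure probabilities
  \<open>P(x, x - 1\<^sub>j)\<close>, all other entries being \<open>0\<close>.\<close>

definition transition ::
  "('c::finite \<Rightarrow> real) \<Rightarrow> ('c \<Rightarrow> 'c \<Rightarrow> real) \<Rightarrow> (('c \<Rightarrow> nat) \<Rightarrow> 'c \<Rightarrow> 'c)
     \<Rightarrow> ('c \<Rightarrow> nat) \<Rightarrow> ('c \<Rightarrow> nat) \<Rightarrow> real"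
where
  "transition \<nu> \<rho> \<phi> x y =
     (\<Sum>i\<in>UNIV. if y = x(i := x i + 1)
        then \<nu> i * (1 - \<rho> i (\<phi> x i)) ^ x (\<phi> x i) else 0) +
     (\<Sum>j\<in>UNIV. if x j > 0 \<and> y = x(j := x j - 1)
        then (\<Sum>i | \<phi> x i = j. \<nu> i * (1 - (1 - \<rho> i j) ^ x j)) else 0)"

section \<open>Markov chains on a countable state space\<close>

text \<open>The Markov property is stated in multiplied-out form, so that histories of
  probability \<open>0\<close> need no separate treatment.\<close>

definition markov_chain ::
  "'w measure \<Rightarrow> (nat \<Rightarrow> 'w \<Rightarrow> 's::countable) \<Rightarrow> ('s \<Rightarrow> 's \<Rightarrow> real) \<Rightarrow> 's \<Rightarrow> bool"
where
  "markov_chain M X P s \<longleftrightarrow>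
     prob_space M \<and>
     (\<forall>t. X t \<in> M \<rightarrow>\<^sub>M count_space UNIV) \<and>
     (AE \<omega> in M. X 0 \<omega> = s) \<and>
     (\<forall>t h y. measure M {\<omega> \<in> space M. (\<forall>u\<le>t. X u \<omega> = h u) \<and> X (Suc t) \<omega> = y} =
        measure M {\<omega> \<in> space M. \<forall>u\<le>t. X u \<omega> = h u} * P (h t) y)"

definition state_space :: "'w measure \<Rightarrow> (nat \<Rightarrow> 'w \<Rightarrow> 's) \<Rightarrow> 's set" where
  "state_space M X = {x. \<exists>t. measure M {\<omega> \<in> space M. X t \<omega> = x} > 0}"

fun n_step :: "'s set \<Rightarrow> ('s \<Rightarrow> 's \<Rightarrow> real) \<Rightarrow> nat \<Rightarrow> 's \<Rightarrow> 's \<Rightarrow> real" where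
  "n_step S P 0 x y = (if x = y then 1 else 0)"
| "n_step S P (Suc n) x y = (\<Sum>\<^sub>\<infinity>z\<in>S. P x z * n_step S P n z y)"

definition irreducible_chain :: "'s set \<Rightarrow> ('s \<Rightarrow> 's \<Rightarrow> real) \<Rightarrow> bool" where
  "irreducible_chain S P \<longleftrightarrow> (\<forall>x\<in>S. \<forall>y\<in>S. \<exists>n. n_step S P n x y > 0)"

definition invariant_distribution :: "'s set \<Rightarrow> ('s \<Rightarrow> 's \<Rightarrow> real) \<Rightarrow> 's pmf \<Rightarrow> bool" where
  "invariant_distribution S P \<pi> \<longleftrightarrow>
     set_pmf \<pi> \<subseteq> S \<and> (\<forall>y\<in>S. ((\<lambda>x. pmf \<pi> x * P x y) has_sum pmf \<pi> y) S)"

text \<open>Used for irreducible chains only; there it is equivalent to positive recurrence.\<close>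

definition stable_chain :: "'s set \<Rightarrow> ('s \<Rightarrow> 's \<Rightarrow> real) \<Rightarrow> bool" where
  "stable_chain S P \<longleftrightarrow> (\<exists>!\<pi>. invariant_distribution S P \<pi>)"

end

theory Submission
  imports Defs
begin

text \<open>
  Put \<open>V x = (\<Sum>i. (x i)\<^sup>2)\<close> and let an arrival of class \<open>i\<close> in state \<open>x\<close> remain
  unmatched with probability \<open>q i\<close>.  One step changes \<open>V\<close> on average by
  \<open>1 + 2 * (\<Sum>i. \<nu> i * (q i * x i - (1 - q i) * x (\<phi> x i)))\<close>.  Let \<open>b i\<close> be the length
  of the longest class adjacent to \<open>i\<close>.  The policy inspects a class at least that long up to a bounded
  error, and \<open>q i\<close> decays exponentially in the length of the inspected class.  Hence, up to \<open>\<delta> * max x + O(1)\<close>, only those \<open>i\<close> contribute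
  \<open>x i\<close> for which \<open>b i\<close> stays below a fixed threshold \<open>T\<close>, while every \<open>i\<close> contributes \<open>- b i\<close>.
  Slice both sums by height \<open>t\<close>.  For \<open>t \<ge> T\<close> the slice of the first sum is carried by an
  independent set, since adjacent members would exceed each other's threshold, and the slice of the
  second sum contains the neighbourhood of this set.  NCOND, made uniform by finiteness of the set
  of classes, therefore turns each slice between \<open>T\<close> and \<open>max x\<close> into a loss of at least some \<open>\<epsilon> > 0\<close>, and the
  drift is at most \<open>C - \<epsilon> * max x\<close> (\<open>negative_drift\<close>).  Such a drift keeps the time averages of the
  laws of the chain tight, and any limit point of these averages is an invariant distribution
  (\<open>lyapunov_imp_invariant\<close>).  Irreducibility makes it unique (\<open>invariant_unique\<close>).

  Conversely, let an independent set \<open>I\<close> be at least as heavy as its neighbourhood \<open>N\<close>.  Whatever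
  the policy does, \<open>x(I) - x(N)\<close> has non-negative drift: every arrival in \<open>I\<close> raises it by one, either
  by joining the buffer or by removing an item of \<open>N\<close>, and only an arrival in \<open>N\<close> can lower it, by one.
  Its positive part is then a submartingale with bounded increments.  Under an invariant
  distribution such a process has drift zero at every state that is charged
  (\<open>stationary_submartingale_is_martingale\<close>), but at the empty state, which every invariant
  distribution charges by irreducibility, its drift is \<open>\<nu>(I) > 0\<close>.

  Both directions regard the transition matrix as a kernel of probability mass functions, for which
  an invariant distribution is a fixed point of \<^const>\<open>bind_pmf\<close>.
\<close>

section \<open>Countable chains given by kernels\<close>

lemma has_sum_expectation:
  fixes h :: "'s \<Rightarrow> real"
  assumes "\<And>x. \<bar>h x\<bar> \<le> B"
  shows "((\<lambda>x. pmf p x * h x) has_sum measure_pmf.expectation p h) UNIV"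
proof -
  have abs: "Infinite_Set_Sum.abs_summable_on (\<lambda>x. pmf p x * h x) UNIV"
  proof (rule abs_summable_on_comparison_test)
    show "Infinite_Set_Sum.abs_summable_on (\<lambda>x. B * pmf p x) UNIV"
      by (intro abs_summable_on_cmult_right pmf_abs_summable)
    show "norm (pmf p x * h x) \<le> norm (B * pmf p x)" for x
    proof -
      have "pmf p x * \<bar>h x\<bar> \<le> pmf p x * \<bar>B\<bar>"
        using assms[of x] by (intro mult_left_mono) auto
      thus ?thesis by (simp add: abs_mult mult.commute)
    qed
  qed
  hence "(\<lambda>x. pmf p x * h x) summable_on UNIV"
    by (metis abs_summable_equivalent abs_summable_summable)
  thus ?thesis
    using infsetsum_infsum[OF abs] by (simp add: pmf_expectation_eq_infsetsum)
qed

lemma expectation_bind_bounded: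
  fixes h :: "'s \<Rightarrow> real"
  assumes "\<And>x. \<bar>h x\<bar> \<le> B"
  shows "measure_pmf.expectation (bind_pmf p K) h
    = measure_pmf.expectation p (\<lambda>x. measure_pmf.expectation (K x) h)"
  unfolding measure_pmf_bind
  by (rule integral_bind[where K = "count_space UNIV" and B = B and B' = 1])
     (use assms in \<open>auto simp: measure_pmf.emeasure_eq_measure measure_pmf_in_subprob_algebra\<close>)

lemma abs_expectation_le:
  fixes h :: "'s \<Rightarrow> real"
  assumes "\<And>y. y \<in> set_pmf p \<Longrightarrow> \<bar>h y\<bar> \<le> B"
  shows "\<bar>measure_pmf.expectation p h\<bar> \<le> B"
proof -
  have "B \<ge> 0" using assms set_pmf_not_empty[of p] by fastforce
  have "integrable p h"
    by (rule measure_pmf.integrable_const_bound[where B=B]) (use assms in \<open>auto simp: AE_measure_pmf_iff\<close>)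
  hence "measure_pmf.expectation p h \<le> B" "measure_pmf.expectation p h \<ge> -B"
    using assms by (auto intro!: measure_pmf.integral_le_const measure_pmf.integral_ge_const
        simp: AE_measure_pmf_iff abs_le_iff minus_le_iff)
  thus ?thesis by linarith
qed

lemma n_step_nonneg:
  assumes "\<And>x y. P x y \<ge> 0"
  shows "n_step S P n x y \<ge> 0"
  by (induction n arbitrary: x) (auto intro!: infsum_nonneg mult_nonneg_nonneg assms)

text \<open>A path of positive probability cannot leave a set that is closed under single transitions.  A non-zero
  infinite sum has a non-zero term, so that a first step of the path can be read off from
  \<^const>\<open>n_step\<close> whether or not the sums converge.\<close>

lemma n_step_pos_closed:
  assumes "\<And>x y. P x y \<ge> 0" and "n_step S P n x y > 0" and "x \<in> S" and "x \<in> A"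
    and "\<And>x z. x \<in> A \<Longrightarrow> x \<in> S \<Longrightarrow> P x z > 0 \<Longrightarrow> z \<in> A"
  shows "y \<in> A"
  using assms(2-4)
proof (induction n arbitrary: x)
  case 0
  then show ?case by (auto split: if_splits)
next
  case (Suc n)
  have "\<exists>z\<in>S. P x z * n_step S P n z y \<noteq> 0"
    using Suc.prems(1) infsum_0[of S "\<lambda>z. P x z * n_step S P n z y"] by fastforce
  then obtain z where z: "z \<in> S" "P x z \<noteq> 0" "n_step S P n z y \<noteq> 0" by auto
  hence "P x z > 0" "n_step S P n z y > 0"
    using assms(1)[of x z] n_step_nonneg[of P S n z y, OF assms(1)] by auto
  thus ?case using Suc.IH[of z] Suc.prems z(1) assms(5)[of x z] by blast
qed

text \<open>The Markov property speaks about complete histories, whereas membership in the state space speaks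
  about a single time.  There are only countably many histories up to a given time, so that an event
  \<open>X t = x\<close> of positive probability contains a history of positive probability, to which the
  property applies.\<close>

lemma markov_chain_state_space:
  assumes "markov_chain M X P s"
  shows "s \<in> state_space M X"
    and "x \<in> state_space M X \<Longrightarrow> P x y > 0 \<Longrightarrow> y \<in> state_space M X"
proof -
  interpret prob_space M using assms by (simp add: markov_chain_def)
  have [measurable]: "X t \<in> M \<rightarrow>\<^sub>M count_space UNIV" for t
    using assms by (simp add: markov_chain_def)
  have "prob {\<omega> \<in> space M. X 0 \<omega> = s} = 1"
    using assms by (subst prob_Collect_eq_1) (auto simp: markov_chain_def)
  thus "s \<in> state_space M X"
    unfolding state_space_def by (auto intro!: exI[of _ 0])
  assume "x \<in> state_space M X" and pos: "P x y > 0"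
  then obtain t where t: "prob {\<omega> \<in> space M. X t \<omega> = x} > 0"
    by (auto simp: state_space_def)
  \<comment> \<open>Histories are cut off after time \<open>t\<close>; as total functions they would be uncountably many.\<close>
  define H where "H = {h \<in> PiE {..t} (\<lambda>_. UNIV). h t = x}"
  define E where "E h = {\<omega> \<in> space M. \<forall>u\<le>t. X u \<omega> = h u}" for h
  have E_sets: "E h \<in> sets M" for h unfolding E_def by measurable
  have "countable H"
    unfolding H_def by (rule countable_subset[OF _ countable_PiE[of "{..t}" "\<lambda>_. UNIV"]]) auto
  have un: "{\<omega> \<in> space M. X t \<omega> = x} \<subseteq> (\<Union>h\<in>H. E h)"
  proof
    fix \<omega> assume "\<omega> \<in> {\<omega> \<in> space M. X t \<omega> = x}"
    hence "restrict (\<lambda>u. X u \<omega>) {..t} \<in> H" "\<omega> \<in> E (restrict (\<lambda>u. X u \<omega>) {..t})"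
      by (auto simp: H_def E_def)
    thus "\<omega> \<in> (\<Union>h\<in>H. E h)" by blast
  qed
  have "\<exists>h\<in>H. prob (E h) > 0"
  proof (rule ccontr)
    assume "\<not> ?thesis"
    hence "E h \<in> null_sets M" if "h \<in> H" for h
      using that E_sets[of h] measure_nonneg[of M "E h"]
      by (auto simp: null_sets_def emeasure_eq_measure not_less intro: antisym)
    hence "(\<Union>h\<in>H. E h) \<in> null_sets M"
      using \<open>countable H\<close> by (intro null_sets_UN') auto
    moreover have "{\<omega> \<in> space M. X t \<omega> = x} \<in> sets M" by measurable
    ultimately have "{\<omega> \<in> space M. X t \<omega> = x} \<in> null_sets M"
      using un null_sets_subset by blast
    thus False using t by (auto simp: null_sets_def emeasure_eq_measure)
  qed
  then obtain h where h: "h t = x" "prob (E h) > 0" by (auto simp: H_def)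
  have "prob {\<omega> \<in> space M. (\<forall>u\<le>t. X u \<omega> = h u) \<and> X (Suc t) \<omega> = y} = prob (E h) * P x y"
    using assms h(1) by (simp add: markov_chain_def E_def)
  also have "\<dots> > 0" using h pos by simp
  finally have "0 < prob {\<omega> \<in> space M. (\<forall>u\<le>t. X u \<omega> = h u) \<and> X (Suc t) \<omega> = y}" .
  also have "\<dots> \<le> prob {\<omega> \<in> space M. X (Suc t) \<omega> = y}"
    by (intro finite_measure_mono) auto
  finally show "y \<in> state_space M X" by (auto simp: state_space_def)
qed

locale closed_kernel =
  fixes K :: "'s::countable \<Rightarrow> 's pmf" and S :: "'s set"
  assumes closed: "x \<in> S \<Longrightarrow> set_pmf (K x) \<subseteq> S"
begin

lemma invariant_distribution_iff:
  "invariant_distribution S (\<lambda>x. pmf (K x)) \<pi> \<longleftrightarrow> set_pmf \<pi> \<subseteq> S \<and> bind_pmf \<pi> K = \<pi>"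
proof (cases "set_pmf \<pi> \<subseteq> S")
  case True
  have "((\<lambda>x. pmf \<pi> x * pmf (K x) y) has_sum pmf (bind_pmf \<pi> K) y) S" for y
  proof -
    have "((\<lambda>x. pmf \<pi> x * pmf (K x) y) has_sum pmf (bind_pmf \<pi> K) y) UNIV"
      unfolding pmf_bind by (rule has_sum_expectation[where B=1]) (auto simp: pmf_le_1)
    thus ?thesis
      by (rule has_sum_cong_neutral[THEN iffD1, rotated -1]) (use True in \<open>auto simp: set_pmf_eq\<close>)
  qed
  moreover have "pmf (bind_pmf \<pi> K) y = 0 \<and> pmf \<pi> y = 0" if "y \<notin> S" for y
    using that True closed by (auto simp: pmf_eq_0_set_pmf set_bind_pmf)
  ultimately show ?thesis
    unfolding invariant_distribution_def pmf_eq_iff using True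
    by (metis (lifting) has_sum_unique)
qed (auto simp: invariant_distribution_def)

end

locale irreducible_kernel = closed_kernel +
  assumes irreducible: "irreducible_chain S (\<lambda>x. pmf (K x))"
begin

lemma closed_subset_is_all:
  assumes "x \<in> S" and "x \<in> A" and "\<And>x. x \<in> A \<Longrightarrow> x \<in> S \<Longrightarrow> set_pmf (K x) \<subseteq> A"
  shows "S \<subseteq> A"
proof
  fix y assume "y \<in> S"
  then obtain n where "n_step S (\<lambda>x. pmf (K x)) n x y > 0"
    using irreducible assms(1) by (auto simp: irreducible_chain_def)
  thus "y \<in> A"
    by (rule n_step_pos_closed[rotated]) (use assms in \<open>auto simp: pmf_positive_iff\<close>)
qed

lemma invariant_support:
  assumes "set_pmf \<pi> \<subseteq> S" and "bind_pmf \<pi> K = \<pi>"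
  shows "set_pmf \<pi> = S"
proof -
  obtain x where "x \<in> set_pmf \<pi>" using set_pmf_not_empty[of \<pi>] by blast
  moreover have "set_pmf (K x) \<subseteq> set_pmf \<pi>" if "x \<in> set_pmf \<pi>" for x
    using that by (subst assms(2)[symmetric]) (auto simp: set_bind_pmf)
  ultimately show ?thesis using closed_subset_is_all[of x "set_pmf \<pi>"] assms(1) by blast
qed

text \<open>Let \<open>A\<close> be the set where \<open>\<pi> < \<pi>'\<close>, and let \<open>g x\<close> be the probability of moving from \<open>x\<close> into
  \<open>A\<close>, minus the indicator of \<open>A\<close>.  Invariance gives \<open>g\<close> mean zero under both distributions.  But
  \<open>g \<le> 0\<close> on \<open>A\<close> and \<open>g \<ge> 0\<close> off \<open>A\<close>, so that every term of \<open>\<Sum>x. (\<pi> x - \<pi>' x) * g x = 0\<close> is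
  non-negative and hence zero.  Thus \<open>A\<close> cannot be left, and by irreducibility it is everything or
  empty; both are impossible for two different distributions.\<close>

lemma invariant_unique:
  assumes "set_pmf \<pi> \<subseteq> S" "bind_pmf \<pi> K = \<pi>"
    and "set_pmf \<pi>' \<subseteq> S" "bind_pmf \<pi>' K = \<pi>'"
  shows "\<pi> = \<pi>'"
proof (rule ccontr)
  assume "\<pi> \<noteq> \<pi>'"
  define A where "A = {x. pmf \<pi> x < pmf \<pi>' x}"
  define g where "g x = measure_pmf.prob (K x) A - indicat_real A x" for x
  have K01: "measure_pmf.prob (K x) A \<ge> 0" "measure_pmf.prob (K x) A \<le> 1" for x
    by (rule measure_nonneg, rule measure_pmf.prob_le_1)
  have bounded: "\<bar>g x\<bar> \<le> 1" for x
    using K01[of x] by (auto simp: g_def indicator_def)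
  have mean: "measure_pmf.expectation p g = 0" if "bind_pmf p K = p" for p
  proof -
    have "measure_pmf.expectation p (indicat_real A)
        = measure_pmf.expectation p (\<lambda>x. measure_pmf.prob (K x) A)"
      using expectation_bind_bounded[of "indicat_real A" 1 p K] that by (simp add: indicator_def)
    thus ?thesis unfolding g_def
      by (subst Bochner_Integration.integral_diff)
         (auto intro!: measure_pmf.integrable_const_bound[where B=1] K01)
  qed
  have "((\<lambda>x. pmf \<pi> x * g x + - (pmf \<pi>' x * g x)) has_sum 0 + - 0) UNIV"
    using has_sum_expectation[where p=\<pi> and h=g, OF bounded] has_sum_expectation[where p=\<pi>' and h=g, OF bounded]
    unfolding mean[OF assms(2)] mean[OF assms(4)] by (intro has_sum_add has_sum_uminusI)
  hence "((\<lambda>x. (pmf \<pi> x - pmf \<pi>' x) * g x) has_sum 0) UNIV"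
    by (simp add: algebra_simps)
  moreover have "(pmf \<pi> x - pmf \<pi>' x) * g x \<ge> 0" for x
    using K01[of x] by (auto simp: g_def A_def indicator_def mult_nonpos_nonpos not_less)
  ultimately have zero: "(pmf \<pi> x - pmf \<pi>' x) * g x = 0" for x
    by (intro nonneg_has_sum_le_0D[where A=UNIV]) auto
  have A_closed: "set_pmf (K x) \<subseteq> A" if "x \<in> A" for x
  proof -
    have "measure (K x) A = 1" using zero[of x] that by (auto simp: A_def g_def)
    thus ?thesis by (simp add: measure_pmf.prob_eq_1 AE_measure_pmf_iff subset_eq)
  qed
  obtain x where "x \<in> A" using pmf_neq_exists_less[OF \<open>\<pi> \<noteq> \<pi>'\<close>] by (auto simp: A_def)
  moreover from this have "x \<in> S"
    using assms(3) pmf_nonneg[of \<pi> x] unfolding A_def by (force simp: set_pmf_iff)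
  ultimately have "S \<subseteq> A" using closed_subset_is_all[of x A] A_closed by blast
  moreover obtain y where "pmf \<pi>' y < pmf \<pi> y"
    using pmf_neq_exists_less \<open>\<pi> \<noteq> \<pi>'\<close> by metis
  moreover from this have "y \<in> S"
    using assms(1) pmf_nonneg[of \<pi>' y] by (force simp: set_pmf_iff)
  ultimately show False by (auto simp: A_def)
qed

lemma stable_chain_iff:
  "stable_chain S (\<lambda>x. pmf (K x)) \<longleftrightarrow> (\<exists>\<pi>. set_pmf \<pi> \<subseteq> S \<and> bind_pmf \<pi> K = \<pi>)"
  unfolding stable_chain_def invariant_distribution_iff using invariant_unique by blast

end

section \<open>Stationary submartingales and the Foster-Lyapunov criterion\<close>

text \<open>For bounded \<open>g\<close> the stationary mean of the drift is \<open>\<pi>(K g) - \<pi>(g) = 0\<close>, and a non-negative drift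
  of mean zero vanishes on the support.  An unbounded \<open>g\<close> may fail to be integrable, so it is
  truncated: truncation does not increase the increments, and dominated convergence with
  the bound \<open>c\<close> carries the zero mean over to the drift of \<open>g\<close>.\<close>

lemma stationary_submartingale_is_martingale:
  fixes g :: "'s \<Rightarrow> real"
  assumes inv: "bind_pmf \<pi> K = \<pi>"
    and inc: "\<And>x y. x \<in> set_pmf \<pi> \<Longrightarrow> y \<in> set_pmf (K x) \<Longrightarrow> \<bar>g y - g x\<bar> \<le> c"
    and sub: "\<And>x. x \<in> set_pmf \<pi> \<Longrightarrow> g x \<le> measure_pmf.expectation (K x) g"
    and x: "x \<in> set_pmf \<pi>"
  shows "measure_pmf.expectation (K x) g = g x"
proof -
  define h where "h N x = max (- real N) (min (real N) (g x))" for N x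
  define D where "D N x = measure_pmf.expectation (K x) (h N) - h N x" for N x
  define D' where "D' x = measure_pmf.expectation (K x) g - g x" for x
  have h_le: "\<bar>h N x\<bar> \<le> real N" for N x by (auto simp: h_def)
  have int: "integrable (measure_pmf p) (h N)" for p N
    by (rule measure_pmf.integrable_const_bound[where B="real N"]) (use h_le in auto)
  have D_mean: "measure_pmf.expectation \<pi> (D N) = 0" for N
  proof -
    have "integrable (measure_pmf \<pi>) (\<lambda>x. measure_pmf.expectation (K x) (h N))"
      by (rule measure_pmf.integrable_const_bound[where B="real N"])
         (use h_le in \<open>auto intro: abs_expectation_le\<close>)
    thus ?thesis
      unfolding D_def using int expectation_bind_bounded[of "h N" "real N" \<pi> K, OF h_le]
      by (simp add: inv)
  qed
  have D_le: "\<bar>D N x\<bar> \<le> c" if "x \<in> set_pmf \<pi>" for N x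
  proof -
    have "D N x = measure_pmf.expectation (K x) (\<lambda>y. h N y - h N x)"
      unfolding D_def using int by simp
    moreover have "\<bar>h N y - h N x\<bar> \<le> c" if "y \<in> set_pmf (K x)" for y
      using inc[OF \<open>x \<in> set_pmf \<pi>\<close> that] by (auto simp: h_def)
    ultimately show ?thesis using abs_expectation_le by metis
  qed
  have D_lim: "(\<lambda>N. D N x) \<longlonglongrightarrow> D' x" if "x \<in> set_pmf \<pi>" for x
  proof -
    \<comment> \<open>Increments are bounded, so a high truncation level affects \<open>g\<close> neither at \<open>x\<close> nor at its successors.\<close>
    have "D N x = D' x" if "N \<ge> nat \<lceil>\<bar>g x\<bar> + \<bar>c\<bar>\<rceil>" for N
    proof -
      have N: "real N \<ge> \<bar>g x\<bar> + \<bar>c\<bar>" using that by linarith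
      hence "h N y = g y" if "y \<in> set_pmf (K x)" for y
        using inc[OF \<open>x \<in> set_pmf \<pi>\<close> that] by (auto simp: h_def)
      hence "measure_pmf.expectation (K x) (h N) = measure_pmf.expectation (K x) g"
        by (intro integral_cong_AE) (auto simp: AE_measure_pmf_iff)
      moreover have "h N x = g x" using N by (auto simp: h_def)
      ultimately show ?thesis by (simp add: D_def D'_def)
    qed
    thus ?thesis by (intro tendsto_eventually eventually_sequentiallyI)
  qed
  have D'_int: "integrable (measure_pmf \<pi>) D'"
    by (rule integrable_dominated_convergence[where w="\<lambda>_. c" and s=D])
       (use D_lim D_le in \<open>auto simp: AE_measure_pmf_iff\<close>)
  have "(\<lambda>N. measure_pmf.expectation \<pi> (D N)) \<longlonglongrightarrow> measure_pmf.expectation \<pi> D'"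
    by (rule integral_dominated_convergence[where w="\<lambda>_. c"])
       (use D_lim D_le in \<open>auto simp: AE_measure_pmf_iff\<close>)
  hence "measure_pmf.expectation \<pi> D' = 0"
    unfolding D_mean using LIMSEQ_unique tendsto_const by blast
  moreover have "AE x in \<pi>. 0 \<le> D' x"
    using sub by (auto simp: AE_measure_pmf_iff D'_def)
  ultimately have "AE x in \<pi>. D' x = 0"
    using integral_nonneg_eq_0_iff_AE[OF D'_int] by simp
  thus ?thesis using x by (auto simp: AE_measure_pmf_iff D'_def)
qed

text \<open>Point masses lie in a product of countably many copies of \<open>[0, 1]\<close>, which is sequentially compact;
  tightness prevents the limit from losing mass.\<close>

lemma tight_pmf_convergent_subsequence:
  fixes p :: "nat \<Rightarrow> 's::countable pmf"
  assumes tight: "\<And>e. e > 0 \<Longrightarrow> \<exists>F. finite F \<and> (\<forall>n. measure_pmf.prob (p n) F \<ge> 1 - e)"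
  shows "\<exists>r q. strict_mono r \<and> (\<forall>x. (\<lambda>n. pmf (p (r n)) x) \<longlonglongrightarrow> pmf q x)"
proof -
  have "compact (PiE UNIV (\<lambda>_. {0..1}) :: ('s \<Rightarrow> real) set)"
    using compactin_PiE[where I=UNIV and X="\<lambda>_::'s. euclidean :: real topology" and S="\<lambda>_. {0..1}"]
    by (simp add: euclidean_product_topology)
  hence "seq_compact (PiE UNIV (\<lambda>_. {0..1}) :: ('s \<Rightarrow> real) set)"
    by (rule compact_imp_seq_compact)
  moreover have "\<forall>n. pmf (p n) \<in> PiE UNIV (\<lambda>_. {0..1})" by (auto simp: pmf_le_1)
  ultimately obtain l r where l: "l \<in> PiE UNIV (\<lambda>_. {0..1})" and r: "strict_mono (r :: nat \<Rightarrow> nat)"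
    and lim: "((\<lambda>n. pmf (p n)) \<circ> r) \<longlonglongrightarrow> l"
    by (rule seq_compactE)
  have conv: "(\<lambda>n. pmf (p (r n)) x) \<longlonglongrightarrow> l x" for x
    using continuous_on_tendsto_compose[OF continuous_on_product_coordinates lim, of x]
    by (simp add: o_def)
  have nonneg: "l x \<ge> 0" for x using l by (auto simp: PiE_def Pi_def)
  have conv_sum: "(\<lambda>n. measure_pmf.prob (p (r n)) F) \<longlonglongrightarrow> sum l F" if "finite F" for F
    using that by (simp add: measure_measure_pmf_finite tendsto_sum conv)
  have sum_le: "sum l F \<le> 1" if "finite F" for F
    by (rule LIMSEQ_le_const2[OF conv_sum[OF that]]) auto
  have summable: "l summable_on UNIV"
    using sum_le nonneg by (intro nonneg_bdd_above_summable_on) (auto intro!: bdd_aboveI[of _ 1])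
  have "infsum l UNIV \<ge> 1 - e" if "e > 0" for e
  proof -
    obtain F where F: "finite F" "\<And>n. measure_pmf.prob (p n) F \<ge> 1 - e"
      using tight[OF \<open>e > 0\<close>] by auto
    have "1 - e \<le> sum l F"
      by (rule LIMSEQ_le_const[OF conv_sum[OF F(1)]]) (use F(2) in auto)
    also have "\<dots> \<le> infsum l UNIV"
      using summable F(1) nonneg by (intro finite_sum_le_infsum) auto
    finally show ?thesis .
  qed
  hence "infsum l UNIV \<ge> 1" by (meson diff_le_eq field_le_epsilon)
  moreover have "infsum l UNIV \<le> 1" using infsum_le_finite_sums[OF summable] sum_le by blast
  ultimately have total: "infsum l UNIV = 1" by simp
  have abs: "Infinite_Set_Sum.abs_summable_on l UNIV"
    using summable nonneg by (simp add: abs_summable_equivalent[symmetric])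
  have "(\<integral>\<^sup>+x. ennreal (l x) \<partial>count_space UNIV) = 1"
    using nn_integral_conv_infsetsum[OF abs] infsetsum_infsum[OF abs] total nonneg by simp
  hence "pmf (embed_pmf l) x = l x" for x
    using nonneg by (intro pmf_embed_pmf) auto
  hence "\<forall>x. (\<lambda>n. pmf (p (r n)) x) \<longlonglongrightarrow> pmf (embed_pmf l) x" using conv by simp
  thus ?thesis using r by blast
qed

context closed_kernel
begin

text \<open>Existence half of the Foster-Lyapunov criterion.  Summing the drift inequality along the chain bounds
  the time average of the mean of \<open>L\<close> uniformly, because \<open>V\<close> stays non-negative.  As \<open>L\<close> has finite
  sublevel sets, Markov's inequality makes the time averages of the laws tight.  One step changes an
  average over \<open>n + 1\<close> times by at most \<open>1 / (n + 1)\<close> at each point, so that a limit point is invariant;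
  finitely many predecessors of each state allow passing to the limit in the transition sum.\<close>

lemma lyapunov_imp_invariant:
  fixes V L :: "'s \<Rightarrow> real"
  assumes fin_out: "\<And>x. finite (set_pmf (K x))"
    and fin_in: "\<And>y. finite {x. y \<in> set_pmf (K x)}"
    and V: "\<And>x. V x \<ge> 0" and L: "\<And>x. L x \<ge> 0"
    and sublevel: "\<And>r. finite {x. L x \<le> r}"
    and drift: "\<And>x. measure_pmf.expectation (K x) V + L x \<le> V x + C"
    and s: "s \<in> S"
  shows "\<exists>\<pi>. set_pmf \<pi> \<subseteq> S \<and> bind_pmf \<pi> K = \<pi>"
proof -
  define \<mu> where "\<mu> t = ((\<lambda>p. bind_pmf p K) ^^ t) (return_pmf s)" for t
  have \<mu>_Suc: "\<mu> (Suc t) = bind_pmf (\<mu> t) K" for t by (simp add: \<mu>_def)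
  have \<mu>_fin: "finite (set_pmf (\<mu> t))" for t
    by (induction t) (auto simp: \<mu>_Suc fin_out, simp add: \<mu>_def)
  have \<mu>_S: "set_pmf (\<mu> t) \<subseteq> S" for t
  proof (induction t)
    case 0 show ?case using s by (simp add: \<mu>_def)
  next
    case (Suc t) thus ?case using closed by (auto simp: \<mu>_Suc set_bind_pmf)
  qed
  have int: "integrable (measure_pmf (\<mu> t)) f" for t and f :: "'s \<Rightarrow> real"
    using \<mu>_fin by (rule integrable_measure_pmf_finite)
  have energy: "measure_pmf.expectation (\<mu> n) V + (\<Sum>t<n. measure_pmf.expectation (\<mu> t) L)
      \<le> V s + real n * C" for n
  proof (induction n)
    case 0 show ?case by (simp add: \<mu>_def)
  next
    case (Suc n)
    have "measure_pmf.expectation (\<mu> (Suc n)) V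
        = measure_pmf.expectation (\<mu> n) (\<lambda>x. measure_pmf.expectation (K x) V)"
      unfolding \<mu>_Suc
      by (subst pmf_expectation_bind[OF \<mu>_fin fin_out order_refl])
         (simp add: integral_measure_pmf[OF \<mu>_fin])
    also have "\<dots> \<le> measure_pmf.expectation (\<mu> n) (\<lambda>x. V x + C - L x)"
      by (rule integral_mono[OF int int]) (use drift in \<open>auto simp: le_diff_eq\<close>)
    also have "\<dots> = measure_pmf.expectation (\<mu> n) V + C - measure_pmf.expectation (\<mu> n) L"
      by (simp add: int)
    finally show ?case using Suc.IH by (simp add: algebra_simps)
  qed
  define p where "p n = bind_pmf (pmf_of_set {..n}) \<mu>" for n
  have pmf_p: "pmf (p n) x = (\<Sum>t\<le>n. pmf (\<mu> t) x) / (real n + 1)" for n x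
    unfolding p_def by (subst pmf_bind_pmf_of_set) (auto simp: add.commute)
  have mean_L: "measure_pmf.expectation (p n) L \<le> V s + \<bar>C\<bar>" for n
  proof -
    have "measure_pmf.expectation (p n) L
        = (\<Sum>t\<le>n. measure_pmf.expectation (\<mu> t) L) / (real n + 1)"
      unfolding p_def
      by (subst pmf_expectation_bind_pmf_of_set) (auto simp: \<mu>_fin sum_divide_distrib field_simps)
    also have "\<dots> \<le> (V s + (real n + 1) * C) / (real n + 1)"
    proof (rule divide_right_mono)
      have "0 \<le> measure_pmf.expectation (\<mu> (Suc n)) V" by (simp add: integral_nonneg_AE V)
      thus "(\<Sum>t\<le>n. measure_pmf.expectation (\<mu> t) L) \<le> V s + (real n + 1) * C"
        using energy[of "Suc n"] by (simp add: lessThan_Suc_atMost add.commute)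
    qed simp
    also have "\<dots> = V s / (real n + 1) + C" by (simp add: field_simps)
    also have "\<dots> \<le> V s + \<bar>C\<bar>"
      using V[of s] by (intro add_mono) (auto simp: divide_le_eq mult_le_cancel_left1)
    finally show ?thesis .
  qed
  have p_fin: "finite (set_pmf (p n))" for n
    by (simp add: p_def set_bind_pmf \<mu>_fin)
  have p_tight: "\<exists>F. finite F \<and> (\<forall>n. measure_pmf.prob (p n) F \<ge> 1 - e)" if "e > 0" for e
  proof -
    \<comment> \<open>The summand \<open>1\<close> keeps \<open>R\<close> positive when \<open>V s\<close> and \<open>C\<close> vanish.\<close>
    define R where "R = (V s + \<bar>C\<bar>) / e + 1"
    have "R > 0" using V[of s] \<open>e > 0\<close> by (simp add: R_def add_nonneg_pos)
    have "measure_pmf.prob (p n) {x. L x \<le> R} \<ge> 1 - e" for n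
    proof -
      have "measure_pmf.prob (p n) {x. R \<le> L x} \<le> measure_pmf.expectation (p n) L / R"
        using integral_Markov_inequality_measure[of "measure_pmf (p n)" L "{}" R]
          \<open>R > 0\<close> L p_fin by (simp add: integrable_measure_pmf_finite)
      also have "\<dots> \<le> (V s + \<bar>C\<bar>) / R"
        using mean_L \<open>R > 0\<close> by (intro divide_right_mono) auto
      also have "\<dots> \<le> e"
        using \<open>e > 0\<close> \<open>R > 0\<close> V[of s] by (simp add: divide_le_eq R_def field_simps)
      finally have "measure_pmf.prob (p n) {x. R \<le> L x} \<le> e" .
      moreover have "measure_pmf.prob (p n) (- {x. L x \<le> R}) \<le> measure_pmf.prob (p n) {x. R \<le> L x}"
        by (intro measure_pmf.finite_measure_mono) auto
      ultimately show ?thesis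
        using measure_pmf.prob_compl[of "{x. L x \<le> R}" "p n"] by (simp add: Compl_eq_Diff_UNIV)
    qed
    thus ?thesis using sublevel by blast
  qed
  obtain r \<pi> where r: "strict_mono r" and conv: "\<And>x. (\<lambda>n. pmf (p (r n)) x) \<longlonglongrightarrow> pmf \<pi> x"
    using tight_pmf_convergent_subsequence[OF p_tight] by blast
  have "set_pmf \<pi> \<subseteq> S"
  proof
    fix x assume "x \<in> set_pmf \<pi>"
    show "x \<in> S"
    proof (rule ccontr)
      assume "x \<notin> S"
      hence "pmf (p n) x = 0" for n
        unfolding pmf_p using \<mu>_S by (auto simp: pmf_eq_0_set_pmf subset_eq intro!: sum.neutral)
      hence "pmf \<pi> x = 0" using conv[of x] LIMSEQ_unique[OF _ tendsto_const] by simp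
      thus False using \<open>x \<in> set_pmf \<pi>\<close> by (simp add: set_pmf_iff)
    qed
  qed
  moreover have "pmf (bind_pmf \<pi> K) y = pmf \<pi> y" for y
  proof -
    define F where "F = {x. y \<in> set_pmf (K x)}"
    have step: "pmf (bind_pmf q K) y = (\<Sum>x\<in>F. pmf q x * pmf (K x) y)" for q
      unfolding pmf_bind
      by (subst integral_measure_pmf[of F])
         (use fin_in in \<open>auto simp: F_def set_pmf_iff\<close>)
    have "(\<lambda>n. pmf (bind_pmf (p (r n)) K) y) \<longlonglongrightarrow> pmf (bind_pmf \<pi> K) y"
      unfolding step by (intro tendsto_sum tendsto_mult conv tendsto_const)
    moreover have "(\<lambda>n. pmf (bind_pmf (p (r n)) K) y - pmf (p (r n)) y) \<longlonglongrightarrow> 0"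
    proof -
      have diff: "\<bar>pmf (bind_pmf (p n) K) y - pmf (p n) y\<bar> \<le> 1 / (real n + 1)" for n
      proof -
        have "pmf (bind_pmf (p n) K) y = (\<Sum>t\<le>n. pmf (\<mu> (Suc t)) y) / (real n + 1)"
          unfolding p_def bind_assoc_pmf \<mu>_Suc
          by (subst pmf_bind_pmf_of_set) (auto simp: add.commute)
        hence "pmf (bind_pmf (p n) K) y - pmf (p n) y
            = (\<Sum>t\<le>n. pmf (\<mu> (Suc t)) y - pmf (\<mu> t) y) / (real n + 1)"
          by (simp add: pmf_p sum_subtractf diff_divide_distrib)
        also have "(\<Sum>t\<le>n. pmf (\<mu> (Suc t)) y - pmf (\<mu> t) y) = pmf (\<mu> (Suc n)) y - pmf (\<mu> 0) y"
          by (induction n) simp_all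
        finally have "pmf (bind_pmf (p n) K) y - pmf (p n) y
            = (pmf (\<mu> (Suc n)) y - pmf (\<mu> 0) y) / (real n + 1)" .
        moreover have "\<bar>pmf (\<mu> (Suc n)) y - pmf (\<mu> 0) y\<bar> \<le> 1"
          using pmf_nonneg[of "\<mu> (Suc n)" y] pmf_le_1[of "\<mu> (Suc n)" y]
            pmf_nonneg[of "\<mu> 0" y] pmf_le_1[of "\<mu> 0" y] by linarith
        ultimately show ?thesis by (simp add: abs_divide divide_right_mono)
      qed
      have "(\<lambda>n. 1 / (real n + 1)) \<longlonglongrightarrow> 0"
        using LIMSEQ_inverse_real_of_nat by (simp add: inverse_eq_divide add.commute)
      hence "(\<lambda>n. pmf (bind_pmf (p n) K) y - pmf (p n) y) \<longlonglongrightarrow> 0"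
        by (rule Lim_null_comparison[rotated]) (use diff in auto)
      from LIMSEQ_subseq_LIMSEQ[OF this r] show ?thesis by (simp add: o_def)
    qed
    ultimately have "(\<lambda>n. pmf (p (r n)) y) \<longlonglongrightarrow> pmf (bind_pmf \<pi> K) y - 0"
      using tendsto_diff by fastforce
    thus ?thesis using LIMSEQ_unique[OF conv] by simp
  qed
  ultimately show ?thesis by (auto simp: pmf_eq_iff)
qed

end

section \<open>The matching chain as a kernel\<close>

locale matching_model =
  fixes \<nu> :: "'c::finite \<Rightarrow> real" and \<rho> :: "'c \<Rightarrow> 'c \<Rightarrow> real"
    and \<phi> :: "('c \<Rightarrow> nat) \<Rightarrow> 'c \<Rightarrow> 'c"
  assumes \<nu>_pos: "\<nu> i > 0" and \<nu>_sum: "(\<Sum>i\<in>UNIV. \<nu> i) = 1"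
    and \<rho>_nonneg: "\<rho> i j \<ge> 0" and \<rho>_le_1: "\<rho> i j \<le> 1" and \<rho>_sym: "\<rho> i j = \<rho> j i"
begin

text \<open>The probability that an arrival of class \<open>i\<close> in state \<open>x\<close> finds no match.\<close>

definition miss :: "('c \<Rightarrow> nat) \<Rightarrow> 'c \<Rightarrow> real" where
  "miss x i = (1 - \<rho> i (\<phi> x i)) ^ x (\<phi> x i)"

definition arrival_class :: "'c pmf" where
  "arrival_class = embed_pmf \<nu>"

text \<open>A departure subtracts from the inspected class without checking that it is non-empty: if it is
  empty, then \<^term>\<open>miss x i = 1\<close> and the branch has probability \<open>0\<close>.\<close>

definition kernel :: "('c \<Rightarrow> nat) \<Rightarrow> ('c \<Rightarrow> nat) pmf" where
  "kernel x = bind_pmf arrival_class (\<lambda>i. map_pmf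
     (\<lambda>missed. if missed then x(i := x i + 1) else x(\<phi> x i := x (\<phi> x i) - 1))
     (bernoulli_pmf (miss x i)))"

lemma miss_bounds: "0 \<le> miss x i" "miss x i \<le> 1"
  using \<rho>_nonneg \<rho>_le_1 by (auto simp: miss_def intro: power_le_one)

lemma matched_compatible:
  assumes "miss x i \<noteq> 1"
  shows "x (\<phi> x i) > 0" "\<rho> i (\<phi> x i) > 0"
  using assms \<rho>_nonneg[of i "\<phi> x i"] by (auto simp: miss_def less_eq_real_def intro: gr0I)

lemma pmf_arrival_class [simp]: "pmf arrival_class i = \<nu> i"
  unfolding arrival_class_def using \<nu>_pos \<nu>_sum
  by (intro pmf_embed_pmf) (auto simp: nn_integral_count_space_finite less_imp_le)

lemma expectation_kernel:
  "measure_pmf.expectation (kernel x) g =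
    (\<Sum>i\<in>UNIV. \<nu> i * (miss x i * g (x(i := x i + 1))
        + (1 - miss x i) * g (x(\<phi> x i := x (\<phi> x i) - 1))))"
  for g :: "_ \<Rightarrow> real"
  unfolding kernel_def
  by (subst pmf_expectation_bind[of UNIV]) (simp_all add: miss_bounds mult.commute)

lemma pmf_kernel: "pmf (kernel x) y = transition \<nu> \<rho> \<phi> x y"
proof -
  let ?dep = "\<lambda>j. x(j := x j - 1)"
  have "pmf (kernel x) y = measure_pmf.expectation (kernel x) (indicat_real {y})"
    by (simp add: measure_pmf_single)
  also have "\<dots> = (\<Sum>i\<in>UNIV. if y = x(i := x i + 1) then \<nu> i * miss x i else 0)
      + (\<Sum>i\<in>UNIV. if y = ?dep (\<phi> x i) then \<nu> i * (1 - miss x i) else 0)"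
    unfolding expectation_kernel sum.distrib[symmetric]
    by (intro sum.cong) (auto simp: indicator_def algebra_simps)
  also have "(\<Sum>i\<in>UNIV. if y = ?dep (\<phi> x i) then \<nu> i * (1 - miss x i) else 0)
      = (\<Sum>j\<in>UNIV. \<Sum>i | \<phi> x i = j. if y = ?dep (\<phi> x i) then \<nu> i * (1 - miss x i) else 0)"
    by (subst sum.group[of UNIV UNIV "\<phi> x", symmetric]) auto
  also have "\<dots> = (\<Sum>j\<in>UNIV. if x j > 0 \<and> y = ?dep j
      then (\<Sum>i | \<phi> x i = j. \<nu> i * (1 - (1 - \<rho> i j) ^ x j)) else 0)"
    by (intro sum.cong) (auto simp: miss_def intro!: sum.cong sum.neutral)
  finally show ?thesis by (simp only: transition_def miss_def)
qed

text \<open>A necessary condition only: a departure from an empty class, which leaves the state unchanged, is not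
  excluded here.  It suffices for bounding increments and for finiteness.\<close>

lemma kernel_cases:
  assumes "y \<in> set_pmf (kernel x)"
  obtains (arrival) i where "y = x(i := x i + 1)" | (departure) j where "y = x(j := x j - 1)"
  using assms by (auto simp: kernel_def set_bind_pmf split: if_splits)

lemma finite_bounded_states: "finite {x :: 'c \<Rightarrow> nat. \<forall>i. x i \<le> b i}"
proof -
  have "{x :: 'c \<Rightarrow> nat. \<forall>i. x i \<le> b i} = PiE UNIV (\<lambda>i. {..b i})"
    by (auto simp: PiE_def Pi_def)
  thus ?thesis by (simp add: finite_PiE)
qed

lemma finite_kernel_support: "finite (set_pmf (kernel x))"
  by (simp add: kernel_def set_bind_pmf)

lemma finite_kernel_predecessors: "finite {x. y \<in> set_pmf (kernel x)}"
proof (rule finite_subset[OF _ finite_bounded_states[of "\<lambda>i. y i + 1"]])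
  show "{x. y \<in> set_pmf (kernel x)} \<subseteq> {x. \<forall>i. x i \<le> y i + 1}"
    by (auto elim!: kernel_cases)
qed

end

section \<open>Instability from a heavy independent set\<close>

locale heavy_independent_set = matching_model \<nu> \<rho> \<phi>
  for \<nu> :: "'c::finite \<Rightarrow> real" and \<rho> :: "'c \<Rightarrow> 'c \<Rightarrow> real"
    and \<phi> :: "('c \<Rightarrow> nat) \<Rightarrow> 'c \<Rightarrow> 'c" +
  fixes I :: "'c set"
  assumes I_nonempty: "I \<noteq> {}" and I_independent: "graph_independent (root_edge \<rho>) I"
    and I_heavy: "sum \<nu> I \<ge> sum \<nu> (neighbourhood (root_edge \<rho>) I)"
begin

definition N :: "'c set" where "N = neighbourhood (root_edge \<rho>) I"

definition sign :: "'c \<Rightarrow> real" where "sign i = indicat_real I i - indicat_real N i"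

text \<open>The difference between the numbers of items in \<open>I\<close> and in its neighbourhood.\<close>

definition excess :: "('c \<Rightarrow> nat) \<Rightarrow> real" where "excess x = (\<Sum>i\<in>UNIV. sign i * real (x i))"

lemma neighbour_iff: "j \<in> N \<longleftrightarrow> (\<exists>i\<in>I. \<rho> i j > 0)"
  by (simp add: N_def neighbourhood_def root_edge_def)

lemma disjoint: "i \<in> I \<Longrightarrow> i \<notin> N"
  using I_independent by (auto simp: neighbour_iff graph_independent_def root_edge_def)

lemma sign_cases: "sign i = (if i \<in> I then 1 else if i \<in> N then -1 else 0)"
  using disjoint by (auto simp: sign_def)

lemma excess_0: "excess (\<lambda>_. 0) = 0"
  by (simp add: excess_def)

lemma excess_arrival: "excess (x(i := x i + 1)) = excess x + sign i"
proof -
  have "excess (x(i := x i + 1)) = (\<Sum>k\<in>UNIV. sign k * real (x k) + (if k = i then sign i else 0))"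
    unfolding excess_def by (intro sum.cong) (auto simp: algebra_simps)
  thus ?thesis by (simp add: sum.distrib excess_def)
qed

lemma excess_departure:
  assumes "x j > 0"
  shows "excess (x(j := x j - 1)) = excess x - sign j"
  using excess_arrival[of "x(j := x j - 1)" j] assms by simp

text \<open>A match joins adjacent classes.  If the arrival is in \<open>I\<close>, its partner is in \<open>N\<close>; if the partner
  is in \<open>I\<close>, the arrival is in \<open>N\<close>.  In both cases a match changes the excess exactly as joining the
  buffer would have done, and otherwise it does so at least as favourably.\<close>

lemma excess_after_match:
  assumes "miss x i \<noteq> 1"
  shows "excess x + sign i \<le> excess (x(\<phi> x i := x (\<phi> x i) - 1))"
proof -
  note * = matched_compatible[OF assms]
  have "\<phi> x i \<in> N" if "i \<in> I" using that * by (auto simp: neighbour_iff)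
  moreover have "i \<in> N" if "\<phi> x i \<in> I" using that * by (auto simp: neighbour_iff \<rho>_sym[of i])
  ultimately show ?thesis
    unfolding excess_departure[of x "\<phi> x i", OF *(1)] using disjoint by (auto simp: sign_cases)
qed

lemma excess_submartingale: "excess x \<le> measure_pmf.expectation (kernel x) excess"
proof -
  have "(\<Sum>i\<in>UNIV. \<nu> i * sign i) = sum \<nu> I - sum \<nu> N"
    by (simp add: sign_def right_diff_distrib sum_subtractf indicator_def if_distrib
        sum.If_cases cong: if_cong)
  hence "excess x \<le> excess x + (\<Sum>i\<in>UNIV. \<nu> i * sign i)"
    using I_heavy by (simp add: N_def)
  also have "\<dots> = (\<Sum>i\<in>UNIV. \<nu> i * (excess x + sign i))"
    by (simp add: distrib_left sum.distrib sum_distrib_right[symmetric] \<nu>_sum)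
  also have "\<dots> \<le> measure_pmf.expectation (kernel x) excess"
    unfolding expectation_kernel
  proof (intro sum_mono mult_left_mono)
    fix i
    have "(1 - miss x i) * (excess x + sign i) \<le> (1 - miss x i) * excess (x(\<phi> x i := x (\<phi> x i) - 1))"
      using excess_after_match[of x i] miss_bounds[of x i]
      by (cases "miss x i = 1") (auto intro: mult_left_mono)
    thus "excess x + sign i \<le> miss x i * excess (x(i := x i + 1))
        + (1 - miss x i) * excess (x(\<phi> x i := x (\<phi> x i) - 1))"
      unfolding excess_arrival by (simp add: algebra_simps)
  qed (use \<nu>_pos in \<open>auto intro: less_imp_le\<close>)
  finally show ?thesis .
qed

lemma excess_increment:
  assumes "y \<in> set_pmf (kernel x)"
  shows "\<bar>excess y - excess x\<bar> \<le> 1"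
  using assms
proof (cases rule: kernel_cases)
  case (arrival i)
  thus ?thesis by (simp only: excess_arrival) (simp add: sign_cases)
next
  case (departure j)
  thus ?thesis
    by (cases "x j = 0") (auto simp: excess_departure[simplified] sign_cases fun_upd_idem)
qed

text \<open>At the empty state every arrival joins the buffer, and one in \<open>I\<close> makes the excess positive.\<close>

lemma positive_excess_grows_at_0:
  "0 < measure_pmf.expectation (kernel (\<lambda>_. 0)) (\<lambda>x. max 0 (excess x))"
proof -
  obtain i where "i \<in> I" using I_nonempty by auto
  have "0 < \<nu> i * max 0 (sign i)" using \<open>i \<in> I\<close> \<nu>_pos by (simp add: sign_cases)
  also have "\<dots> \<le> (\<Sum>i\<in>UNIV. \<nu> i * max 0 (sign i))"
    by (rule member_le_sum) (auto simp: \<nu>_pos less_imp_le)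
  also have "\<dots> = measure_pmf.expectation (kernel (\<lambda>_. 0)) (\<lambda>x. max 0 (excess x))"
    using excess_arrival[of "\<lambda>_. 0"] excess_0 by (simp add: expectation_kernel miss_def)
  finally show ?thesis .
qed

lemma invariant_avoids_empty_state:
  assumes inv: "bind_pmf \<pi> kernel = \<pi>"
  shows "(\<lambda>_. 0) \<notin> set_pmf \<pi>"
proof
  assume charged: "(\<lambda>_. 0) \<in> set_pmf \<pi>"
  have "measure_pmf.expectation (kernel (\<lambda>_. 0)) (\<lambda>x. max 0 (excess x)) = max 0 (excess (\<lambda>_. 0))"
  proof (rule stationary_submartingale_is_martingale[OF inv _ _ charged])
    show "\<bar>max 0 (excess y) - max 0 (excess x)\<bar> \<le> 1" if "y \<in> set_pmf (kernel x)" for x y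
      using excess_increment[OF that] by linarith
    show "max 0 (excess x) \<le> measure_pmf.expectation (kernel x) (\<lambda>y. max 0 (excess y))" for x
    proof -
      have int: "integrable (kernel x) f" for f :: "_ \<Rightarrow> real"
        using finite_kernel_support by (rule integrable_measure_pmf_finite)
      have "measure_pmf.expectation (kernel x) excess
          \<le> measure_pmf.expectation (kernel x) (\<lambda>y. max 0 (excess y))"
        by (rule integral_mono[OF int int]) simp
      moreover have "0 \<le> measure_pmf.expectation (kernel x) (\<lambda>y. max 0 (excess y))"
        by (simp add: integral_nonneg_AE)
      ultimately show ?thesis using excess_submartingale[of x] by linarith
    qed
  qed
  thus False
    using positive_excess_grows_at_0 excess_0 by simp
qed

end

section \<open>Drift under NCOND\<close>

text \<open>Slicing by height turns a comparison of weighted sums of lengths into a comparison of the weights of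
  level sets, to which NCOND applies.\<close>

lemma weighted_layer_cake:
  fixes c :: "'a \<Rightarrow> real"
  assumes "finite A" and "\<And>a. a \<in> A \<Longrightarrow> n a \<le> (L :: nat)"
  shows "(\<Sum>a\<in>A. c a * real (n a)) = (\<Sum>t<L. sum c {a\<in>A. t < n a})"
proof -
  have "c a * real (n a) = (\<Sum>t<L. if t < n a then c a else 0)" if "a \<in> A" for a
  proof -
    have "{t\<in>{..<L}. t < n a} = {..<n a}" using assms(2)[OF that] by auto
    thus ?thesis by (simp flip: sum.inter_filter)
  qed
  hence "(\<Sum>a\<in>A. c a * real (n a)) = (\<Sum>t<L. \<Sum>a\<in>A. if t < n a then c a else 0)"
    by (simp add: sum.swap[of _ _ A])
  thus ?thesis using assms(1) by (simp flip: sum.inter_filter)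
qed

text \<open>The \<open>n\<close>-th power is at most each of the first \<open>n\<close> terms of the geometric series.\<close>

lemma mult_power_le_inverse:
  fixes r :: real
  assumes "0 < r" "r \<le> 1"
  shows "real n * (1 - r) ^ n \<le> 1 / r"
proof -
  have "real n * (1 - r) ^ n = (\<Sum>k<n. (1 - r) ^ n)" by simp
  also have "\<dots> \<le> (\<Sum>k<n. (1 - r) ^ k)"
    using assms by (intro sum_mono power_decreasing) auto
  also have "\<dots> = (1 - (1 - r) ^ n) / r"
    using assms by (simp add: sum_gp_strict)
  also have "\<dots> \<le> 1 / r" using assms by (simp add: divide_right_mono)
  finally show ?thesis .
qed

text \<open>All that stability requires of the policy: it does not overlook a compatible item, and the class it
  inspects is, up to a constant, as long as any compatible class.\<close>

locale longest_matching = matching_model \<nu> \<rho> \<phi>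
  for \<nu> :: "'c::finite \<Rightarrow> real" and \<rho> :: "'c \<Rightarrow> 'c \<Rightarrow> real"
    and \<phi> :: "('c \<Rightarrow> nat) \<Rightarrow> 'c \<Rightarrow> 'c" +
  assumes NCOND: "NCOND (root_edge \<rho>) \<nu>"
    and finds_match: "\<rho> i k > 0 \<Longrightarrow> x k > 0 \<Longrightarrow> \<rho> i (\<phi> x i) > 0"
    and near_longest: "\<exists>m. \<forall>x i k. \<rho> i k > 0 \<longrightarrow> x k \<le> x (\<phi> x i) + m"
begin

text \<open>An isolated class would form an independent set with an empty neighbourhood.\<close>

lemma ex_neighbour: "\<exists>j. \<rho> i j > 0"
proof (cases "\<rho> i i > 0")
  case False
  hence "sum \<nu> {i} < sum \<nu> (neighbourhood (root_edge \<rho>) {i})"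
    using NCOND[unfolded NCOND_def, rule_format, of "{i}"]
    by (simp add: graph_independent_def root_edge_def)
  hence "neighbourhood (root_edge \<rho>) {i} \<noteq> {}" using \<nu>_pos[of i] by auto
  thus ?thesis by (auto simp: neighbourhood_def root_edge_def)
qed auto

text \<open>There are finitely many sets of classes, so the strict inequalities of NCOND hold with a common
  margin.  The bound for arbitrary non-empty sets serves those heights at which no class counts as
  blocked.\<close>

lemma NCOND_uniform:
  obtains \<epsilon> where "\<epsilon> > 0"
    and "\<And>A. A \<noteq> {} \<Longrightarrow> sum \<nu> (neighbourhood (root_edge \<rho>) A) \<ge> \<epsilon>"
    and "\<And>A. A \<noteq> {} \<Longrightarrow> graph_independent (root_edge \<rho>) A \<Longrightarrow>
            sum \<nu> (neighbourhood (root_edge \<rho>) A) \<ge> sum \<nu> A + \<epsilon>"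
proof -
  let ?N = "\<lambda>A. sum \<nu> (neighbourhood (root_edge \<rho>) A)"
  define Z where "Z = ?N ` {A. A \<noteq> {}}
    \<union> (\<lambda>A. ?N A - sum \<nu> A) ` {A. A \<noteq> {} \<and> graph_independent (root_edge \<rho>) A}"
  have "finite Z" by (simp add: Z_def)
  moreover have "Z \<noteq> {}" by (auto simp: Z_def)
  moreover have "z > 0" if "z \<in> Z" for z
  proof -
    have "?N A > 0" if "A \<noteq> {}" for A
      using that ex_neighbour \<nu>_pos
      by (intro sum_pos) (auto simp: neighbourhood_def root_edge_def)
    thus ?thesis using \<open>z \<in> Z\<close> NCOND by (auto simp: Z_def NCOND_def)
  qed
  moreover have "Min Z \<le> ?N A" if "A \<noteq> {}" for A
    using that \<open>finite Z\<close> by (intro Min_le) (auto simp: Z_def)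
  moreover have "Min Z \<le> ?N A - sum \<nu> A"
    if "A \<noteq> {}" "graph_independent (root_edge \<rho>) A" for A
    using that \<open>finite Z\<close> by (intro Min_le) (auto simp: Z_def)
  ultimately show thesis using that[of "Min Z"] by (simp add: le_diff_eq add.commute)
qed

lemma ex_min_edge:
  obtains r where "0 < r" "r \<le> 1" "\<And>i j. \<rho> i j > 0 \<Longrightarrow> \<rho> i j \<ge> r"
proof -
  define Z where "Z = insert 1 (range (case_prod \<rho>) \<inter> {0<..})"
  have "finite Z" by (simp add: Z_def)
  hence "Min Z \<in> Z" by (intro Min_in) (simp_all add: Z_def)
  moreover have "0 < z" if "z \<in> Z" for z using that by (auto simp: Z_def)
  moreover have "Min Z \<le> \<rho> i j" if "\<rho> i j > 0" for i j
  proof -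
    have "\<rho> i j \<in> range (case_prod \<rho>)" by (rule range_eqI[of _ _ "(i, j)"]) simp
    thus ?thesis using that \<open>finite Z\<close> by (intro Min_le) (simp_all add: Z_def)
  qed
  moreover have "Min Z \<le> 1" using \<open>finite Z\<close> by (intro Min_le) (auto simp: Z_def)
  ultimately show thesis using that[of "Min Z"] by simp
qed

definition longest :: "('c \<Rightarrow> nat) \<Rightarrow> nat" where
  "longest x = Max (range x)"

definition nbr_longest :: "('c \<Rightarrow> nat) \<Rightarrow> 'c \<Rightarrow> nat" where
  "nbr_longest x i = Max (x ` {j. \<rho> i j > 0})"

lemma le_longest: "x i \<le> longest x"
  by (simp add: longest_def)

lemma nbr_longest_gt_iff: "t < nbr_longest x i \<longleftrightarrow> (\<exists>j. \<rho> i j > 0 \<and> t < x j)"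
  unfolding nbr_longest_def using ex_neighbour by (subst Max_gr_iff) auto

lemma nbr_longest_attained: "\<exists>j. \<rho> i j > 0 \<and> x j = nbr_longest x i"
proof -
  have "nbr_longest x i \<in> x ` {j. \<rho> i j > 0}"
    unfolding nbr_longest_def using ex_neighbour by (intro Max_in) auto
  thus ?thesis by auto
qed

lemma nbr_longest_le_longest: "nbr_longest x i \<le> longest x"
proof -
  obtain j where "x j = nbr_longest x i" using nbr_longest_attained by blast
  thus ?thesis using le_longest[of x j] by simp
qed

definition energy :: "('c \<Rightarrow> nat) \<Rightarrow> real" where
  "energy x = (\<Sum>i\<in>UNIV. (real (x i))\<^sup>2)"

lemma energy_upd: "energy (x(i := k)) = energy x - (real (x i))\<^sup>2 + (real k)\<^sup>2"
proof -
  have "energy (x(i := k))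
      = (\<Sum>j\<in>UNIV. (real (x j))\<^sup>2 + (if j = i then (real k)\<^sup>2 - (real (x i))\<^sup>2 else 0))"
    unfolding energy_def by (intro sum.cong) auto
  thus ?thesis by (simp add: sum.distrib energy_def)
qed

text \<open>A departure from an empty class, where \<open>(n - 1)\<^sup>2 = n\<^sup>2 - 2 * n + 1\<close> fails for truncated
  subtraction, carries weight \<open>0\<close>.\<close>

lemma energy_drift:
  "measure_pmf.expectation (kernel x) energy = energy x + 1
    + 2 * (\<Sum>i\<in>UNIV. \<nu> i * (miss x i * real (x i) - (1 - miss x i) * real (x (\<phi> x i))))"
proof -
  have step: "\<nu> i * (miss x i * energy (x(i := x i + 1))
        + (1 - miss x i) * energy (x(\<phi> x i := x (\<phi> x i) - 1)))
      = \<nu> i * (energy x + 1)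
        + 2 * (\<nu> i * (miss x i * real (x i) - (1 - miss x i) * real (x (\<phi> x i))))" for i
  proof (cases "miss x i = 1")
    case True
    thus ?thesis by (simp add: energy_upd power2_eq_square algebra_simps)
  next
    case False
    then obtain n where "x (\<phi> x i) = Suc n" using matched_compatible gr0_implies_Suc by blast
    thus ?thesis by (simp add: energy_upd power2_eq_square algebra_simps)
  qed
  show ?thesis
    unfolding expectation_kernel step
    by (simp add: sum.distrib \<nu>_sum flip: sum_distrib_right sum_distrib_left)
qed

text \<open>The neighbourhood of \<open>{i. t < x i}\<close> is the level set of \<^const>\<open>nbr_longest\<close> at height \<open>t\<close>.  Among
  the classes without a neighbour of length \<open>T\<close>, those longer than \<open>t \<ge> T\<close> are independent.  Hence
  the margin of NCOND applies, unless there are none, and then any neighbourhood is heavy enough.\<close>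

lemma level_set_balance:
  assumes \<epsilon>: "\<epsilon> > 0" "\<And>A. A \<noteq> {} \<Longrightarrow> sum \<nu> (neighbourhood (root_edge \<rho>) A) \<ge> \<epsilon>"
    "\<And>A. A \<noteq> {} \<Longrightarrow> graph_independent (root_edge \<rho>) A \<Longrightarrow>
            sum \<nu> (neighbourhood (root_edge \<rho>) A) \<ge> sum \<nu> A + \<epsilon>"
    and t: "T \<le> t" "t < longest x"
  shows "sum \<nu> {i. nbr_longest x i < T \<and> t < x i} + \<epsilon> \<le> sum \<nu> {i. t < nbr_longest x i}"
proof -
  let ?A = "{i. nbr_longest x i < T \<and> t < x i}" and ?B = "{i. t < x i}"
  have nbr: "neighbourhood (root_edge \<rho>) ?B = {i. t < nbr_longest x i}"
    using \<rho>_sym by (auto simp: neighbourhood_def root_edge_def nbr_longest_gt_iff)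
  have "?B \<noteq> {}"
    using t(2) unfolding longest_def by (subst (asm) Max_gr_iff) auto
  have indep: "graph_independent (root_edge \<rho>) ?A"
    unfolding graph_independent_def root_edge_def
  proof (intro ballI notI)
    fix i j assume "i \<in> ?A" "j \<in> ?A" "\<rho> i j > 0"
    hence "t < nbr_longest x i" by (auto simp: nbr_longest_gt_iff)
    thus False using \<open>i \<in> ?A\<close> t(1) by simp
  qed
  show ?thesis
  proof (cases "?A = {}")
    case True
    thus ?thesis using \<epsilon>(2)[OF \<open>?B \<noteq> {}\<close>] by (simp only: nbr sum.empty)
  next
    case False
    have "sum \<nu> (neighbourhood (root_edge \<rho>) ?A) \<le> sum \<nu> (neighbourhood (root_edge \<rho>) ?B)"
      using \<nu>_pos by (intro sum_mono2) (auto simp: neighbourhood_def less_imp_le)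
    thus ?thesis using \<epsilon>(3)[OF False indep] unfolding nbr by linarith
  qed
qed

text \<open>Each height between \<open>T\<close> and the maximum loses \<open>\<epsilon>\<close>; each of the at most \<open>T\<close> heights below gains at
  most the total weight \<open>1\<close>.\<close>

lemma blocked_mass_bound:
  assumes \<epsilon>: "\<epsilon> > 0" "\<And>A. A \<noteq> {} \<Longrightarrow> sum \<nu> (neighbourhood (root_edge \<rho>) A) \<ge> \<epsilon>"
    "\<And>A. A \<noteq> {} \<Longrightarrow> graph_independent (root_edge \<rho>) A \<Longrightarrow>
            sum \<nu> (neighbourhood (root_edge \<rho>) A) \<ge> sum \<nu> A + \<epsilon>"
  shows "(\<Sum>i | nbr_longest x i < T. \<nu> i * real (x i)) - (\<Sum>i\<in>UNIV. \<nu> i * real (nbr_longest x i))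
    \<le> (1 + \<epsilon>) * real T - \<epsilon> * real (longest x)"
proof -
  let ?a = "\<lambda>t. sum \<nu> {i. nbr_longest x i < T \<and> t < x i}"
  let ?b = "\<lambda>t. sum \<nu> {i. t < nbr_longest x i}"
  have "(\<Sum>i | nbr_longest x i < T. \<nu> i * real (x i)) = (\<Sum>t<longest x. ?a t)"
    using weighted_layer_cake[of "{i. nbr_longest x i < T}" x "longest x" \<nu>] le_longest by simp
  moreover have "(\<Sum>i\<in>UNIV. \<nu> i * real (nbr_longest x i)) = (\<Sum>t<longest x. ?b t)"
    using weighted_layer_cake[of UNIV "nbr_longest x" "longest x" \<nu>] nbr_longest_le_longest by simp
  moreover have "(\<Sum>t<longest x. ?a t - ?b t)
      \<le> (\<Sum>t<longest x. (1 + \<epsilon>) * of_bool (t < T) - \<epsilon>)"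
  proof (rule sum_mono)
    fix t assume t: "t \<in> {..<longest x}"
    show "?a t - ?b t \<le> (1 + \<epsilon>) * of_bool (t < T) - \<epsilon>"
    proof (cases "t < T")
      case True
      have "?a t \<le> sum \<nu> UNIV" using \<nu>_pos by (intro sum_mono2) (auto simp: less_imp_le)
      moreover have "?b t \<ge> 0" using \<nu>_pos by (intro sum_nonneg) (auto simp: less_imp_le)
      ultimately show ?thesis using True \<nu>_sum by simp
    next
      case False
      thus ?thesis using level_set_balance[OF \<epsilon>, of T t x] t by simp
    qed
  qed
  moreover have "(\<Sum>t<longest x. of_bool (t < T)) \<le> real T"
  proof -
    have "(\<Sum>t<longest x. of_bool (t < T)) = real (card ({..<longest x} \<inter> {t. t < T}))"
      by (simp add: sum_of_bool_eq)
    also have "\<dots> \<le> real (card {..<T})" by (intro of_nat_mono card_mono) auto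
    finally show ?thesis by simp
  qed
  hence "(1 + \<epsilon>) * (\<Sum>t<longest x. of_bool (t < T)) \<le> (1 + \<epsilon>) * real T"
    using \<epsilon>(1) by (intro mult_left_mono) auto
  ultimately show ?thesis
    by (simp add: sum_subtractf sum_distrib_left[symmetric] mult.commute)
qed

text \<open>Half of the margin \<open>\<epsilon>\<close> pays for arrivals that fail to match although they have a long neighbour:
  beyond a suitable threshold \<open>T\<close> this happens with probability at most \<open>\<epsilon> / 2\<close>, and the class of the
  arrival is no longer than the maximum.\<close>

lemma negative_drift:
  "\<exists>\<epsilon>>0. \<exists>C. \<forall>x. measure_pmf.expectation (kernel x) energy + \<epsilon> * real (longest x) \<le> energy x + C"
proof -
  obtain \<epsilon> where \<epsilon>: "\<epsilon> > 0" "\<And>A. A \<noteq> {} \<Longrightarrow> sum \<nu> (neighbourhood (root_edge \<rho>) A) \<ge> \<epsilon>"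
    "\<And>A. A \<noteq> {} \<Longrightarrow> graph_independent (root_edge \<rho>) A \<Longrightarrow>
            sum \<nu> (neighbourhood (root_edge \<rho>) A) \<ge> sum \<nu> A + \<epsilon>"
    by (rule NCOND_uniform) blast
  obtain r where r: "0 < r" "r \<le> 1" "\<And>i j. \<rho> i j > 0 \<Longrightarrow> \<rho> i j \<ge> r"
    by (rule ex_min_edge) blast
  obtain m where m: "\<And>x i k. \<rho> i k > 0 \<Longrightarrow> x k \<le> x (\<phi> x i) + m"
    using near_longest by blast
  obtain n where n: "(1 - r) ^ n < \<epsilon> / 2"
    using real_arch_pow_inv[of "\<epsilon> / 2" "1 - r"] \<epsilon>(1) r by auto
  \<comment> \<open>A neighbour of length \<open>T\<close> forces the policy to inspect more than \<open>n\<close> items.\<close>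
  define T where "T = m + n + 1"
  \<comment> \<open>The loss \<open>m\<close> is due to the policy, \<open>1 / r\<close> to failed attempts.\<close>
  define D where "D = real m + 1 / r"
  have match_long: "nbr_longest x i \<le> x (\<phi> x i) + m" for x i
    using nbr_longest_attained[of i x] m by metis
  have miss_le: "miss x i \<le> (1 - r) ^ x (\<phi> x i)" if long: "nbr_longest x i > 0" for x i
  proof -
    obtain j where "\<rho> i j > 0" "x j > 0" using long nbr_longest_gt_iff[of 0 x i] by blast
    hence "\<rho> i (\<phi> x i) \<ge> r" using finds_match r(3) by blast
    thus ?thesis unfolding miss_def using \<rho>_le_1 by (intro power_mono) auto
  qed
  have matched: "(1 - miss x i) * real (x (\<phi> x i)) \<ge> real (nbr_longest x i) - D" for x i
  proof (cases "nbr_longest x i > 0")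
    case True
    have "miss x i * real (x (\<phi> x i)) \<le> (1 - r) ^ x (\<phi> x i) * real (x (\<phi> x i))"
      using miss_le[OF True] by (intro mult_right_mono) auto
    also have "\<dots> \<le> 1 / r" using mult_power_le_inverse[OF r(1,2)] by (simp add: mult.commute)
    finally show ?thesis using match_long[of x i] by (simp add: D_def algebra_simps)
  next
    case False
    moreover have "D \<ge> 0" using r(1) by (simp add: D_def)
    ultimately have "real (nbr_longest x i) - D \<le> 0" by simp
    also have "\<dots> \<le> (1 - miss x i) * real (x (\<phi> x i))" using miss_bounds[of x i] by simp
    finally show ?thesis .
  qed
  have missed: "miss x i * real (x i)
      \<le> \<epsilon> / 2 * real (longest x) + (if nbr_longest x i < T then real (x i) else 0)" for x i
  proof (cases "nbr_longest x i < T")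
    case True
    have "miss x i * real (x i) \<le> real (x i)"
      using miss_bounds[of x i] by (intro mult_left_le_one_le) auto
    thus ?thesis using True \<epsilon>(1) by (simp add: add_increasing)
  next
    case False
    have "miss x i \<le> (1 - r) ^ x (\<phi> x i)" using False by (intro miss_le) (simp add: T_def)
    also have "\<dots> \<le> (1 - r) ^ n"
      using False match_long[of x i] r by (intro power_decreasing) (auto simp: T_def)
    finally have "miss x i \<le> \<epsilon> / 2" using n by simp
    hence "miss x i * real (x i) \<le> \<epsilon> / 2 * real (longest x)"
      using le_longest \<epsilon>(1) by (intro mult_mono) auto
    thus ?thesis using False by simp
  qed
  have "measure_pmf.expectation (kernel x) energy + \<epsilon> * real (longest x)
      \<le> energy x + (1 + 2 * D + 2 * (1 + \<epsilon>) * real T)" for x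
  proof -
    have "(\<Sum>i\<in>UNIV. \<nu> i * (miss x i * real (x i) - (1 - miss x i) * real (x (\<phi> x i))))
        \<le> (\<Sum>i\<in>UNIV. \<nu> i * ((\<epsilon> / 2 * real (longest x) + D)
            + (if nbr_longest x i < T then real (x i) else 0) - real (nbr_longest x i)))"
    proof (intro sum_mono mult_left_mono)
      show "miss x i * real (x i) - (1 - miss x i) * real (x (\<phi> x i))
        \<le> (\<epsilon> / 2 * real (longest x) + D)
            + (if nbr_longest x i < T then real (x i) else 0) - real (nbr_longest x i)" for i
        using matched[of x i] missed[of x i] by linarith
    qed (use \<nu>_pos in \<open>auto intro: less_imp_le\<close>)
    also have "\<dots> = (\<Sum>i\<in>UNIV. \<nu> i * (\<epsilon> / 2 * real (longest x) + D))
        + (\<Sum>i\<in>UNIV. \<nu> i * (if nbr_longest x i < T then real (x i) else 0))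
        - (\<Sum>i\<in>UNIV. \<nu> i * real (nbr_longest x i))"
      by (simp only: distrib_left right_diff_distrib sum.distrib sum_subtractf)
    also have "(\<Sum>i\<in>UNIV. \<nu> i * (\<epsilon> / 2 * real (longest x) + D)) = \<epsilon> / 2 * real (longest x) + D"
      by (simp add: \<nu>_sum flip: sum_distrib_right)
    also have "(\<Sum>i\<in>UNIV. \<nu> i * (if nbr_longest x i < T then real (x i) else 0))
        = (\<Sum>i | nbr_longest x i < T. \<nu> i * real (x i))"
      by (simp add: if_distrib sum.If_cases cong: if_cong)
    finally show ?thesis
      unfolding energy_drift using blocked_mass_bound[OF \<epsilon>, of x T] by (simp add: algebra_simps)
  qed
  thus ?thesis using \<epsilon>(1) by blast
qed

lemma finite_longest_sublevel: "finite {x. real (longest x) \<le> b}"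
proof (rule finite_subset[OF _ finite_bounded_states[of "\<lambda>_. nat \<lceil>b\<rceil>"]])
  have "x i \<le> nat \<lceil>b\<rceil>" if "real (longest x) \<le> b" for x i
  proof -
    have "real (x i) \<le> b" using le_longest[of x i] that by linarith
    thus ?thesis by linarith
  qed
  thus "{x. real (longest x) \<le> b} \<subseteq> {x. \<forall>i. x i \<le> nat \<lceil>b\<rceil>}" by auto
qed

lemma ex_invariant:
  assumes "closed_kernel kernel S" and "s \<in> S"
  shows "\<exists>\<pi>. set_pmf \<pi> \<subseteq> S \<and> bind_pmf \<pi> kernel = \<pi>"
proof -
  obtain \<epsilon> C where \<epsilon>: "\<epsilon> > 0"
    and drift: "\<And>x. measure_pmf.expectation (kernel x) energy + \<epsilon> * real (longest x) \<le> energy x + C"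
    using negative_drift by blast
  show ?thesis
  proof (rule closed_kernel.lyapunov_imp_invariant[OF assms(1),
        where V = energy and L = "\<lambda>x. \<epsilon> * real (longest x)" and C = C and s = s])
    show "finite {x. \<epsilon> * real (longest x) \<le> b}" for b
      using finite_longest_sublevel[of "b / \<epsilon>"] \<epsilon> by (simp add: le_divide_eq mult.commute)
  qed (use drift \<epsilon> assms(2) in
    \<open>auto simp: finite_kernel_support finite_kernel_predecessors energy_def sum_nonneg\<close>)
qed

end

section \<open>The policy and the stability theorem\<close>

lemma policy_maximises:
  fixes \<rho> :: "'c::finite \<Rightarrow> 'c \<Rightarrow> real"
  assumes "inj \<alpha>"
  shows "w (x k) (\<rho> i k) \<le> w (x (policy w \<rho> \<alpha> x i)) (\<rho> i (policy w \<rho> \<alpha> x i))"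
proof -
  define v where "v j = w (x j) (\<rho> i j)" for j
  define best where "best j \<longleftrightarrow> (\<forall>k. k \<noteq> j \<longrightarrow>
     ((v k, \<alpha> k), (v j, \<alpha> j)) \<in> {(a, b). a < b} <*lex*> {(a, b). a < b})" for j
  define A where "A = {j. v j = Max (range v)}"
  have "Max (range v) \<in> range v" by (intro Max_in) auto
  then obtain j\<^sub>0 where "v j\<^sub>0 = Max (range v)" by (metis rangeE)
  hence "A \<noteq> {}" by (auto simp: A_def)
  hence "Max (\<alpha> ` A) \<in> \<alpha> ` A" by (intro Max_in) auto
  then obtain j where j: "j \<in> A" "\<alpha> j = Max (\<alpha> ` A)" by auto
  have "best j"
    unfolding best_def
  proof (intro allI impI)
    fix k assume "k \<noteq> j"
    have "v k \<le> v j" using j(1) by (simp add: A_def)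
    moreover have "\<alpha> k < \<alpha> j" if "v k = v j"
    proof -
      have "\<alpha> k \<le> \<alpha> j" using that j by (simp add: A_def)
      thus ?thesis using \<open>inj \<alpha>\<close> \<open>k \<noteq> j\<close> by (metis injD le_neq_implies_less)
    qed
    ultimately show "((v k, \<alpha> k), (v j, \<alpha> j)) \<in> {(a, b). a < b} <*lex*> {(a, b). a < b}"
      by auto
  qed
  moreover have "j' = j" if "best j'" for j'
    using that \<open>best j\<close> unfolding best_def by (rule_tac ccontr) (fastforce dest: spec)
  ultimately have "(THE j. best j) = j" by (rule the_equality)
  hence "policy w \<rho> \<alpha> x i = j" by (simp add: policy_def best_def v_def)
  moreover have "v k \<le> v j" using j(1) by (simp add: A_def)
  ultimately show ?thesis by (simp add: v_def)
qed

text \<open>For a compatible class \<open>k\<close> with \<open>n\<close> items, where \<open>n\<close> is large, the growth condition gives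
  \<open>w (n - 1) 1 < w n (\<rho> i k)\<close>.  So a class with fewer than \<open>n\<close> items is never preferred to \<open>k\<close>, whatever
  its success probability.  The additive constant absorbs small \<open>n\<close>.\<close>

lemma policy_near_longest:
  fixes \<rho> :: "'c::finite \<Rightarrow> 'c \<Rightarrow> real"
  assumes w: "weight_function w" and \<rho>: "\<And>i j. \<rho> i j \<in> {0..1}" and "inj \<alpha>"
  shows "\<exists>m. \<forall>x i k. \<rho> i k > 0 \<longrightarrow> x k \<le> x (policy w \<rho> \<alpha> x i) + m"
proof -
  have "\<exists>M. \<forall>r\<in>{0<..1}. \<forall>n\<ge>M r. w (n - 1) 1 < w n r"
    using w unfolding weight_function_def by (intro bchoice) meson
  then obtain M where M: "\<And>r n. r \<in> {0<..1} \<Longrightarrow> n \<ge> M r \<Longrightarrow> w (n - 1) 1 < w n r" by blast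
  define m where "m = Max (range (\<lambda>(i, k). M (\<rho> i k)))"
  have m: "M (\<rho> i k) \<le> m" for i k unfolding m_def by (intro Max_ge) auto
  have "x k \<le> x (policy w \<rho> \<alpha> x i) + m" if "\<rho> i k > 0" for x i k
  proof (rule ccontr)
    let ?j = "policy w \<rho> \<alpha> x i"
    assume "\<not> x k \<le> x ?j + m"
    hence "x ?j \<le> x k - 1" "M (\<rho> i k) \<le> x k" using m[of i k] by linarith+
    have "w (x k - 1) 1 < w (x k) (\<rho> i k)"
      using M[of "\<rho> i k" "x k"] that \<rho>[of i k] \<open>M (\<rho> i k) \<le> x k\<close> by auto
    also have "\<dots> \<le> w (x ?j) (\<rho> i ?j)" using \<open>inj \<alpha>\<close> by (rule policy_maximises)
    also have "\<dots> \<le> w (x ?j) 1"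
      using w \<rho>[of i ?j] unfolding weight_function_def by (auto simp: mono_on_def)
    also have "\<dots> \<le> w (x k - 1) 1"
      using w \<open>x ?j \<le> x k - 1\<close> unfolding weight_function_def by (auto simp: mono_def)
    finally show False by simp
  qed
  thus ?thesis by blast
qed

lemma policy_finds_match:
  fixes \<rho> :: "'c::finite \<Rightarrow> 'c \<Rightarrow> real"
  assumes w: "weight_function w" and \<rho>: "\<And>i j. \<rho> i j \<in> {0..1}" and "inj \<alpha>"
    and "\<rho> i k > 0" "x k > 0"
  shows "\<rho> i (policy w \<rho> \<alpha> x i) > 0"
proof -
  let ?j = "policy w \<rho> \<alpha> x i"
  have pos: "w n r > 0 \<longleftrightarrow> n > 0 \<and> r > 0" if "r \<in> {0..1}" for n r
    using w that by (auto simp: weight_function_def)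
  have "0 < w (x k) (\<rho> i k)" using pos[OF \<rho>] assms(4,5) by simp
  also have "\<dots> \<le> w (x ?j) (\<rho> i ?j)" using \<open>inj \<alpha>\<close> by (rule policy_maximises)
  finally show ?thesis using pos[OF \<rho>] by blast
qed

theorem corollary3p2:
  fixes \<nu> :: "'c::finite \<Rightarrow> real"
    and \<rho> :: "'c \<Rightarrow> 'c \<Rightarrow> real"
    and w :: "nat \<Rightarrow> real \<Rightarrow> real"
    and \<alpha> :: "'c \<Rightarrow> nat"
    and \<phi> :: "('c \<Rightarrow> nat) \<Rightarrow> 'c \<Rightarrow> 'c"
    and P :: "('c \<Rightarrow> nat) \<Rightarrow> ('c \<Rightarrow> nat) \<Rightarrow> real"
    and M :: "'w measure"
    and X :: "nat \<Rightarrow> 'w \<Rightarrow> ('c \<Rightarrow> nat)"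
  assumes "\<And>i. \<nu> i > 0" and "(\<Sum>i\<in>UNIV. \<nu> i) = 1"
    and "\<And>i j. \<rho> i j \<in> {0..1}" and "\<And>i j. \<rho> i j = \<rho> j i"
    and "weight_function w"
    and "bij_betw \<alpha> UNIV {1..CARD('c)}"
    and "\<phi> = policy w \<rho> \<alpha>"
    and "P = transition \<nu> \<rho> \<phi>"
    and "markov_chain M X P (\<lambda>_. 0)"
    and "irreducible_chain (state_space M X) P"
  shows "stable_chain (state_space M X) P \<longleftrightarrow> NCOND (root_edge \<rho>) \<nu>"
proof -
  interpret matching_model \<nu> \<rho> \<phi>
    using assms(1-4) by unfold_locales auto
  have P: "P = (\<lambda>x. pmf (kernel x))"
    using assms(8) by (simp add: fun_eq_iff pmf_kernel)
  define S where "S = state_space M X"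
  have "inj \<alpha>" using assms(6) by (simp add: bij_betw_def)
  have zero: "(\<lambda>_. 0) \<in> S"
    unfolding S_def using assms(9) by (rule markov_chain_state_space(1))
  interpret irreducible_kernel kernel S
  proof
    show "set_pmf (kernel x) \<subseteq> S" if "x \<in> S" for x
      using that markov_chain_state_space(2)[OF assms(9)]
      by (auto simp: S_def P pmf_positive_iff)
    show "irreducible_chain S (\<lambda>x. pmf (kernel x))" using assms(10) by (simp add: S_def P)
  qed
  have "(\<exists>\<pi>. set_pmf \<pi> \<subseteq> S \<and> bind_pmf \<pi> kernel = \<pi>) \<longleftrightarrow> NCOND (root_edge \<rho>) \<nu>"
  proof
    assume "NCOND (root_edge \<rho>) \<nu>"
    then interpret longest_matching \<nu> \<rho> \<phi>
      using policy_near_longest[OF assms(5,3) \<open>inj \<alpha>\<close>] policy_finds_match[OF assms(5,3) \<open>inj \<alpha>\<close>]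
      by unfold_locales (simp_all add: assms(7))
    show "\<exists>\<pi>. set_pmf \<pi> \<subseteq> S \<and> bind_pmf \<pi> kernel = \<pi>"
      using closed_kernel_axioms zero by (rule ex_invariant)
  next
    assume "\<exists>\<pi>. set_pmf \<pi> \<subseteq> S \<and> bind_pmf \<pi> kernel = \<pi>"
    then obtain \<pi> where \<pi>: "set_pmf \<pi> \<subseteq> S" "bind_pmf \<pi> kernel = \<pi>" by blast
    show "NCOND (root_edge \<rho>) \<nu>"
    proof (rule ccontr)
      assume "\<not> ?thesis"
      then obtain I where "I \<noteq> {}" "graph_independent (root_edge \<rho>) I"
        "sum \<nu> (neighbourhood (root_edge \<rho>) I) \<le> sum \<nu> I"
        by (auto simp: NCOND_def not_less)
      then interpret heavy_independent_set \<nu> \<rho> \<phi> I by unfold_locales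
      have "(\<lambda>_. 0) \<in> set_pmf \<pi>" using invariant_support[OF \<pi>] zero by simp
      thus False using invariant_avoids_empty_state[OF \<pi>(2)] by simp
    qed
  qed
  thus ?thesis using stable_chain_iff by (simp add: S_def P)
qed

end
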